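(* Let $X$ be a Hilbert space, let $A$ with domain $D(A)\subset X$ be the infinitesimal generator of a $C_0$-semigroup $(T(t))_{t\ge 0}$ on $X$, and let $f:X\to X$ be a locally Lipschitz continuous function with $f(0)=0$. Assume that: (i) $f$ is Fréchet differentiable at $0$ with Fréchet derivative equal to zero there; (ii) the semigroup $(T(t))_{t\ge 0}$ is exponentially stable; (iii) there exist $\omega\in\mathbb{R}$ and a bounded, boundedly invertible, self-adjoint operator $Q\in\mathcal{L}(X)$ such that for all $x\in D(A)$ $$\langle x, QAx\rangle+\langle Ax, Qx\rangle\le \omega\|x\|^2 .$$ Then the abstract differential equation $$\dot{x}(t)=Ax(t)+f(x(t)),\qquad x(0)=x_0,$$ is (locally) exponentially stable around zero.
   Context: $\mathcal{L}(X)$ denotes the bounded linear operators from $X$ to $X$. The semigroup $(T(t))_{t\ge0}$ is exponentially stable if there exist $M$ and $\omega_0>0$ such that $\|T(t)\|\le Me^{-\omega_0 t}$ for all $t\ge 0$. Solutions of $\dot x(t)=Ax(t)+f(x(t))$, $x(0)=x_0$, are understood in the mild sense, i.e. continuous functions $x$ with $x(t)=T(t)x_0+\int_0^t T(t-s)f(x(s))\,ds$. "(Locally) exponentially stable around zero" has its standard meaning: there exist $r>0$, $C>0$ and $\alpha>0$ such that for every $x_0\in X$ with $\|x_0\|<r$ the solution $x(t)$ with $x(0)=x_0$ exists for all $t\ge0$ and satisfies $\|x(t)\|\le Ce^{-\alpha t}\|x_0\|$ for all $t\ge 0$. *)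

theory Defs
  imports "HOL-Analysis.Analysis"
begin

section \<open>Hilbert spaces over the real or complex scalars\<close>

text \<open>
  The scalar field of a Hilbert space: a normed field with conjugation. By the Gelfand-Mazur
  theorem the axioms leave only the reals (with trivial conjugation) and the complex numbers.
  The order \<open>a \<le> b\<close> says that \<open>b - a\<close> is a nonnegative real number; on the complex
  numbers this is the order of \<^theory>\<open>HOL-Library.Complex_Order\<close>.
\<close>

class real_or_complex = real_normed_field + ord +
  fixes conjugate :: "'a \<Rightarrow> 'a"
  assumes conjugate_add: "conjugate (a + b) = conjugate a + conjugate b"
    and conjugate_mult: "conjugate (a * b) = conjugate a * conjugate b"
    and conjugate_conjugate: "conjugate (conjugate a) = a"
    and mult_conjugate: "a * conjugate a = (norm a)\<^sup>2 *\<^sub>R 1"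
    and le_iff_diff_nonneg_real: "a \<le> b \<longleftrightarrow> (\<exists>r\<ge>0. b - a = r *\<^sub>R 1)"

instantiation real :: real_or_complex
begin
definition conjugate_real :: "real \<Rightarrow> real" where "conjugate_real a = a"
instance
  by standard
    (auto simp: conjugate_real_def power2_eq_square intro: exI[of _ "b - a" for a b])
end

instantiation complex :: real_or_complex
begin
definition conjugate_complex :: "complex \<Rightarrow> complex" where "conjugate_complex = cnj"
instance
proof
  fix a b :: complex
  show "a * conjugate a = (norm a)\<^sup>2 *\<^sub>R 1"
    by (simp add: conjugate_complex_def complex_norm_square scaleR_conv_of_real del: of_real_power)
  show "a \<le> b \<longleftrightarrow> (\<exists>r\<ge>0. b - a = r *\<^sub>R 1)"
    by (auto simp: less_eq_complex_def complex_eq_iff intro: exI[of _ "Re b - Re a"])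
qed (simp_all add: conjugate_complex_def)
end

text \<open>
  Completeness and the norm topology come from the class \<^class>\<open>banach\<close>; the last axiom says
  that the norm is induced by the inner product, which is linear in its first argument.
\<close>

locale hilbert_space = vector_space smul
  for smul :: "'k::real_or_complex \<Rightarrow> 'x::banach \<Rightarrow> 'x" +
  fixes ip :: "'x \<Rightarrow> 'x \<Rightarrow> 'k"
  assumes smul_of_real: "smul (of_real r) x = r *\<^sub>R x"
    and ip_add_left: "ip (x + y) z = ip x z + ip y z"
    and ip_smul_left: "ip (smul a x) y = a * ip x y"
    and ip_conjugate: "ip y x = conjugate (ip x y)"
    and ip_self: "ip x x = of_real ((norm x)\<^sup>2)"

lemma real_hilbert_space:
  "hilbert_space scaleR (inner :: 'a::{real_inner, banach} \<Rightarrow> 'a \<Rightarrow> real)"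
  by unfold_locales
    (simp_all add: algebra_simps conjugate_real_def inner_commute power2_norm_eq_inner)

lemma complex_hilbert_space:
  "hilbert_space (*) (\<lambda>x y :: complex. x * cnj y)"
  by unfold_locales
    (simp_all add: algebra_simps conjugate_complex_def complex_norm_square scaleR_conv_of_real
      del: of_real_power)


section \<open>Strongly continuous semigroups\<close>

definition c0_semigroup ::
  "('k::real_or_complex \<Rightarrow> 'x::banach \<Rightarrow> 'x) \<Rightarrow> (real \<Rightarrow> 'x \<Rightarrow>\<^sub>L 'x) \<Rightarrow> bool"
where
  "c0_semigroup smul T \<longleftrightarrow>
     (\<forall>t\<ge>0. Vector_Spaces.linear smul smul (blinfun_apply (T t))) \<and>
     T 0 = id_blinfun \<and>
     (\<forall>s\<ge>0. \<forall>t\<ge>0. T (s + t) = T s o\<^sub>L T t) \<and>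
     (\<forall>x. ((\<lambda>t. T t x) \<longlongrightarrow> x) (at_right 0))"

text \<open>\<open>A\<close> is only constrained on its domain \<open>D\<close>; its values outside \<open>D\<close> are junk.\<close>

definition infinitesimal_generator ::
  "(real \<Rightarrow> 'x::banach \<Rightarrow>\<^sub>L 'x) \<Rightarrow> 'x set \<Rightarrow> ('x \<Rightarrow> 'x) \<Rightarrow> bool"
where
  "infinitesimal_generator T D A \<longleftrightarrow>
     D = {x. \<exists>y. ((\<lambda>h. (T h x - x) /\<^sub>R h) \<longlongrightarrow> y) (at_right 0)} \<and>
     (\<forall>x\<in>D. ((\<lambda>h. (T h x - x) /\<^sub>R h) \<longlongrightarrow> A x) (at_right 0))"

definition exponentially_stable_semigroup :: "(real \<Rightarrow> 'x::banach \<Rightarrow>\<^sub>L 'x) \<Rightarrow> bool" where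
  "exponentially_stable_semigroup T \<longleftrightarrow>
     (\<exists>M \<omega>\<^sub>0. \<omega>\<^sub>0 > 0 \<and> (\<forall>t\<ge>0. norm (T t) \<le> M * exp (- \<omega>\<^sub>0 * t)))"


section \<open>Operators and nonlinearities\<close>

definition boundedly_invertible :: "('x::banach \<Rightarrow>\<^sub>L 'x) \<Rightarrow> bool" where
  "boundedly_invertible Q \<longleftrightarrow>
     (\<exists>R :: 'x \<Rightarrow>\<^sub>L 'x. Q o\<^sub>L R = id_blinfun \<and> R o\<^sub>L Q = id_blinfun)"

definition self_adjoint_wrt :: "('x::banach \<Rightarrow> 'x \<Rightarrow> 'k) \<Rightarrow> ('x \<Rightarrow>\<^sub>L 'x) \<Rightarrow> bool" where
  "self_adjoint_wrt ip Q \<longleftrightarrow> (\<forall>x y. ip (Q x) y = ip x (Q y))"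

definition locally_lipschitz :: "('x::metric_space \<Rightarrow> 'x) \<Rightarrow> bool" where
  "locally_lipschitz f \<longleftrightarrow> (\<forall>x. \<exists>u>0. \<exists>L. L-lipschitz_on (cball x u) f)"


section \<open>Mild solutions and stability\<close>

definition mild_solution ::
  "(real \<Rightarrow> 'x::banach \<Rightarrow>\<^sub>L 'x) \<Rightarrow> ('x \<Rightarrow> 'x) \<Rightarrow> 'x \<Rightarrow> (real \<Rightarrow> 'x) \<Rightarrow> bool"
where
  "mild_solution T f x\<^sub>0 x \<longleftrightarrow>
     continuous_on {0..} x \<and>
     (\<forall>t\<ge>0. (\<lambda>s. T (t - s) (f (x s))) integrable_on {0..t} \<and>
            x t = T t x\<^sub>0 + integral {0..t} (\<lambda>s. T (t - s) (f (x s))))"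

text \<open>
  The second conjunct on \<open>x\<close> expresses that \<open>x\<close> is \<^emph>\<open>the\<close> solution starting in \<open>x\<^sub>0\<close>.
\<close>

definition locally_exponentially_stable ::
  "(real \<Rightarrow> 'x::banach \<Rightarrow>\<^sub>L 'x) \<Rightarrow> ('x \<Rightarrow> 'x) \<Rightarrow> bool"
where
  "locally_exponentially_stable T f \<longleftrightarrow>
     (\<exists>r>0. \<exists>C>0. \<exists>\<alpha>>0. \<forall>x\<^sub>0. norm x\<^sub>0 < r \<longrightarrow>
        (\<exists>x. mild_solution T f x\<^sub>0 x \<and>
             (\<forall>y. mild_solution T f x\<^sub>0 y \<longrightarrow> (\<forall>t\<ge>0. y t = x t)) \<and>
             (\<forall>t\<ge>0. norm (x t) \<le> C * exp (- \<alpha> * t) * norm x\<^sub>0)))"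

end

theory Submission
  imports Defs
begin

text \<open>
  Near zero the variation of constants formula and \<open>f x = o(norm x)\<close> give
  \<open>exp (\<omega> t) norm (x t) \<le> M norm x\<^sub>0 + M e \<integral>\<^sub>0\<^sup>t exp (\<omega> s) norm (x s) ds\<close> with \<open>M e = \<omega> / 2\<close>, so by
  Gronwall's inequality a solution decays like \<open>exp (- \<omega> t / 2)\<close> as long as it stays in a small
  ball, and for small \<open>x\<^sub>0\<close> it therefore never leaves it. Replacing \<open>f\<close> outside that ball by its
  composition with the radial retraction makes it globally Lipschitz; the global solution of
  the modified equation, obtained from Banach's fixed point theorem in a weighted supremum norm, stays
  in the ball and hence solves the original equation. Gronwall's inequality applied to differences
  gives uniqueness.
\<close>

section \<open>Gronwall's inequality and local Lipschitz continuity\<close>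

text \<open>With \<open>V t = a + c * integral {0..t} u\<close>, the bound
  \<open>u t \<le> V t\<close> makes \<open>W t = V t * exp (- (c * t))\<close> nonincreasing, since
  \<open>V\<close> has derivative \<open>c * u\<close>. Hence
  \<open>V t \<le> a * exp (c * t)\<close>, and \<open>V\<close> dominates \<open>u\<close>.\<close>

lemma gronwall:
  fixes u :: "real \<Rightarrow> real"
  assumes cont: "continuous_on {0..b} u" and "c \<ge> 0"
    and le: "\<And>t. t \<in> {0..b} \<Longrightarrow> u t \<le> a + c * integral {0..t} u"
    and t: "t \<in> {0..b}"
  shows "u t \<le> a * exp (c * t)"
proof -
  define V where "V t = a + c * integral {0..t} u" for t
  define W where "W t = V t * exp (- (c * t))" for t
  have der: "(W has_real_derivative (c * u s - c * V s) * exp (- (c * s))) (at s within {0..b})"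
    if "s \<in> {0..b}" for s
    unfolding W_def V_def
    by (rule derivative_eq_intros integral_has_real_derivative[OF cont that] refl | simp)+
      (simp add: algebra_simps)
  have "W t \<le> W 0"
  proof (rule DERIV_nonpos_imp_decreasing_open[where f = W])
    show "0 \<le> t" using t by simp
    fix s assume s: "0 < s" "s < t"
    hence "s \<in> {0..b}" "at s within {0..b} = at s"
      using t by (auto intro: at_within_Icc_at)
    moreover have "c * u s \<le> c * V s"
      using le[OF \<open>s \<in> {0..b}\<close>] \<open>c \<ge> 0\<close> by (simp add: V_def mult_left_mono)
    ultimately show "\<exists>y. (W has_real_derivative y) (at s) \<and> y \<le> 0"
      using der[of s] by (auto intro!: exI mult_nonpos_nonneg)
  next
    have "continuous_on {0..b} W"
      by (rule DERIV_continuous_on) (rule der)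
    thus "continuous_on {0..t} W"
      by (rule continuous_on_subset) (use t in auto)
  qed
  hence "V t \<le> a * exp (c * t)"
    by (simp add: W_def V_def exp_minus field_simps)
  thus ?thesis
    using le[OF t] by (simp add: V_def)
qed

lemma locally_lipschitz_imp_continuous_on:
  assumes "locally_lipschitz f"
  shows "continuous_on S f"
proof (rule continuous_at_imp_continuous_on, intro ballI)
  fix x
  obtain u L where "u > 0" "L-lipschitz_on (cball x u) f"
    using assms unfolding locally_lipschitz_def by blast
  hence "continuous_on (ball x u) f"
    by (meson ball_subset_cball continuous_on_subset lipschitz_on_continuous_on)
  thus "isCont f x"
    using \<open>u > 0\<close> by (simp add: continuous_on_eq_continuous_at)
qed

section \<open>Radial retraction onto a ball\<close>

text \<open>For positive \<open>d\<close> the factor is 1 on the closed ball of radius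
  \<open>d\<close> and \<open>d / norm x\<close> outside it; the maximum in the denominator spares a
  case distinction.\<close>

definition radial_retraction :: "real \<Rightarrow> 'a::real_normed_vector \<Rightarrow> 'a" where
  "radial_retraction d x = (d / max d (norm x)) *\<^sub>R x"

lemma radial_retraction_id: "d > 0 \<Longrightarrow> norm x \<le> d \<Longrightarrow> radial_retraction d x = x"
  by (simp add: radial_retraction_def max_def)

lemma norm_radial_retraction:
  assumes "d > 0"
  shows "norm (radial_retraction d x) \<le> d" "norm (radial_retraction d x) \<le> norm x"
proof -
  have *: "norm (radial_retraction d x) = d * norm x / max d (norm x)" and "max d (norm x) > 0"
    using assms by (auto simp: radial_retraction_def)
  show "norm (radial_retraction d x) \<le> d" "norm (radial_retraction d x) \<le> norm x"
    unfolding * using assms \<open>max d (norm x) > 0\<close>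
    by (simp_all add: pos_divide_le_eq mult.commute[of d] mult_left_mono mult_right_mono)
qed

text \<open>Moving the point at a fixed scaling factor and changing the factor itself each
  contribute at most \<open>norm (x - y)\<close>, whence the constant 2.\<close>

lemma norm_radial_retraction_diff_le:
  assumes "d > 0"
  shows "norm (radial_retraction d x - radial_retraction d y) \<le> 2 * norm (x - y)"
proof -
  define a b where "a = max d (norm x)" and "b = max d (norm y)"
  have ab: "a > 0" "b > 0" "d \<le> a" "norm y \<le> b" "d \<le> b" "\<bar>b - a\<bar> \<le> norm (x - y)"
    using assms norm_triangle_ineq3[of x y] by (auto simp: a_def b_def)
  have "radial_retraction d x - radial_retraction d y
      = (d / a) *\<^sub>R (x - y) + ((d / a) * ((b - a) / b)) *\<^sub>R y"
  proof -
    have "(d / a) * ((b - a) / b) = d / a - d / b"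
      using ab by (simp add: field_simps)
    thus ?thesis
      by (simp only: radial_retraction_def a_def[symmetric] b_def[symmetric])
        (simp add: scaleR_diff_left scaleR_diff_right)
  qed
  also have "norm \<dots> \<le> \<bar>d / a\<bar> * norm (x - y) + \<bar>(d / a) * ((b - a) / b)\<bar> * norm y"
    by (rule norm_triangle_mono) auto
  also have "\<dots> = (d / a) * (norm (x - y) + \<bar>b - a\<bar> * (norm y / b))"
    using ab assms by (simp only: abs_mult abs_divide) (simp add: distrib_left)
  \<comment> \<open>Both \<open>d / a\<close> and \<open>norm y / b\<close> are at most 1, and
    \<open>\<bar>b - a\<bar> \<le> norm (x - y)\<close> because the norm and the maximum with
    \<open>d\<close> are 1-Lipschitz.\<close>
  also have "\<dots> \<le> 1 * (norm (x - y) + norm (x - y) * 1)"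
    using ab assms by (intro mult_mono add_mono) auto
  finally show ?thesis by simp
qed

section \<open>Semigroups with an exponential bound\<close>

text \<open>On a nonzero space \<open>M \<ge> 1\<close> follows from
  \<open>T 0 = id_blinfun\<close>; stating it as an assumption covers the zero space as
  well.\<close>

locale exponentially_bounded_semigroup =
  fixes T :: "real \<Rightarrow> 'x::banach \<Rightarrow>\<^sub>L 'x" and M \<omega> :: real
  assumes T_zero: "T 0 = id_blinfun"
    and T_add: "s \<ge> 0 \<Longrightarrow> t \<ge> 0 \<Longrightarrow> T (s + t) = T s o\<^sub>L T t"
    and T_tendsto: "((\<lambda>t. T t x) \<longlongrightarrow> x) (at_right 0)"
    and norm_T_exp_le: "t \<ge> 0 \<Longrightarrow> norm (T t) \<le> M * exp (- \<omega> * t)"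
    and M_ge_1: "M \<ge> 1" and \<omega>_pos: "\<omega> > 0"
begin

lemma norm_T_apply_exp_le: "t \<ge> 0 \<Longrightarrow> norm (T t x) \<le> M * exp (- \<omega> * t) * norm x"
  using norm_blinfun[of "T t" x] mult_right_mono[OF norm_T_exp_le, of t "norm x"] by simp

lemma norm_T_apply_le:
  assumes "t \<ge> 0"
  shows "norm (T t x) \<le> M * norm x"
proof -
  have "M * exp (- \<omega> * t) * norm x \<le> M * 1 * norm x"
    using M_ge_1 \<omega>_pos assms by (intro mult_right_mono mult_left_mono) auto
  thus ?thesis
    using norm_T_apply_exp_le[OF assms, of x] by simp
qed

text \<open>Factoring out the semigroup at the smaller of the two times reduces continuity at any
  time to right continuity at 0.\<close>

lemma norm_T_diff_le:
  assumes "s \<ge> 0" "t \<ge> 0"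
  shows "norm (T s x - T t x) \<le> M * norm (T \<bar>s - t\<bar> x - x)"
  using assms
proof (induction s t rule: linorder_wlog)
  case (le s t)
  have "T t x = T s (T \<bar>s - t\<bar> x)"
    using T_add[of s "t - s"] le by simp
  hence "T s x - T t x = T s (x - T \<bar>s - t\<bar> x)"
    by (simp add: blinfun.diff_right)
  thus ?case
    using norm_T_apply_le[of s "x - T \<bar>s - t\<bar> x"] le by (simp add: norm_minus_commute)
next
  case (sym s t)
  thus ?case by (simp add: norm_minus_commute abs_minus_commute)
qed

text \<open>The uniform bound \<open>M\<close> controls the change of the vector, and
  \<open>norm_T_diff_le\<close> the change of time at the fixed vector \<open>q z\<close>.\<close>

lemma continuous_on_T_apply:
  assumes "continuous_on S p" "continuous_on S q" "\<And>z. z \<in> S \<Longrightarrow> p z \<ge> 0"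
  shows "continuous_on S (\<lambda>z. T (p z) (q z))"
  unfolding continuous_on_def
proof (intro ballI)
  fix z assume z: "z \<in> S"
  have T0: "((\<lambda>t. T t (q z)) \<longlongrightarrow> q z) (at 0 within {0..})"
    using T_tendsto[of "q z"] by (simp add: at_within_Ici_at_right)
  \<comment> \<open>The time difference \<open>\<bar>p y - p z\<bar>\<close> may vanish for
    \<open>y\<close> other than \<open>z\<close>, so the limit must include the point 0 itself,
    where \<open>T 0 = id_blinfun\<close> gives the value \<open>q z\<close>.\<close>
  have T0': "((\<lambda>t. T t (q z)) \<longlongrightarrow> q z) (inf (nhds 0) (principal {0..}))"
    unfolding tendsto_def eventually_inf_principal
  proof (intro allI impI)
    fix U assume U: "open U" "q z \<in> U"
    hence "\<forall>\<^sub>F t in nhds 0. t \<noteq> 0 \<longrightarrow> t \<in> {0..} \<longrightarrow> T t (q z) \<in> U"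
      using T0 by (simp add: tendsto_def eventually_at_filter)
    thus "\<forall>\<^sub>F t in nhds 0. t \<in> {0..} \<longrightarrow> T t (q z) \<in> U"
      by (rule eventually_mono) (use U T_zero in auto)
  qed
  have "((\<lambda>y. \<bar>p y - p z\<bar>) \<longlongrightarrow> 0) (at z within S)"
    using assms(1) z by (auto simp: continuous_on_def intro!: tendsto_rabs_zero LIM_zero)
  hence "filterlim (\<lambda>y. \<bar>p y - p z\<bar>) (inf (nhds 0) (principal {0..})) (at z within S)"
    by (auto simp: filterlim_inf filterlim_principal)
  from filterlim_compose[OF T0' this]
  have *: "((\<lambda>y. T \<bar>p y - p z\<bar> (q z)) \<longlongrightarrow> q z) (at z within S)" .
  have "((\<lambda>y. M * norm (q y - q z) + M * norm (T \<bar>p y - p z\<bar> (q z) - q z))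
      \<longlongrightarrow> M * norm (q z - q z) + M * norm (q z - q z)) (at z within S)"
    using assms(2) z unfolding continuous_on_def by (intro tendsto_intros *) auto
  hence lim: "((\<lambda>y. M * norm (q y - q z) + M * norm (T \<bar>p y - p z\<bar> (q z) - q z)) \<longlongrightarrow> 0)
      (at z within S)"
    by simp
  have "((\<lambda>y. T (p y) (q y) - T (p z) (q z)) \<longlongrightarrow> 0) (at z within S)"
  proof (rule Lim_null_comparison[OF _ lim])
    have "norm (T (p y) (q y) - T (p z) (q z))
        \<le> M * norm (q y - q z) + M * norm (T \<bar>p y - p z\<bar> (q z) - q z)" if "y \<in> S" for y
    proof -
      have "T (p y) (q y) - T (p z) (q z) = T (p y) (q y - q z) + (T (p y) (q z) - T (p z) (q z))"
        by (simp add: blinfun.diff_right)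
      moreover have "norm (T (p y) (q y - q z)) \<le> M * norm (q y - q z)"
        "norm (T (p y) (q z) - T (p z) (q z)) \<le> M * norm (T \<bar>p y - p z\<bar> (q z) - q z)"
        using assms(3) that z by (auto intro: norm_T_apply_le norm_T_diff_le)
      ultimately show ?thesis
        by (simp only: norm_triangle_mono)
    qed
    thus "\<forall>\<^sub>F y in at z within S. norm (T (p y) (q y) - T (p z) (q z))
        \<le> M * norm (q y - q z) + M * norm (T \<bar>p y - p z\<bar> (q z) - q z)"
      by (auto simp: eventually_at_filter)
  qed
  thus "((\<lambda>y. T (p y) (q y)) \<longlongrightarrow> T (p z) (q z)) (at z within S)"
    by (simp add: LIM_zero_iff)
qed

section \<open>Convolution with the semigroup and decay\<close>

lemma continuous_on_convolution_integrand:
  assumes "continuous_on {0..t} w"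
  shows "continuous_on {0..t} (\<lambda>s. T (t - s) (w s))"
  by (intro continuous_on_T_apply continuous_intros assms) auto

lemma continuous_on_convolution:
  assumes "continuous_on {0..} w"
  shows "continuous_on {0..} (\<lambda>t. integral {0..t} (\<lambda>s. T (t - s) (w s)))"
proof -
  \<comment> \<open>Substituting \<open>s = t * r\<close> moves the dependence on \<open>t\<close> from the interval into the integrand.\<close>
  have eq: "integral {0..t} (\<lambda>s. T (t - s) (w s))
      = t *\<^sub>R integral {0..1} (\<lambda>r. T (t - t * r) (w (t * r)))" if "t \<ge> 0" for t
  proof (cases "t = 0")
    case False
    hence t: "t > 0" using that by simp
    have "(\<lambda>s. T (t - s) (w s)) integrable_on {0..t}"
      by (intro integrable_continuous_interval continuous_on_convolution_integrand
          continuous_on_subset[OF assms]) auto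
    from has_integral_stretch_real[OF integrable_integral[OF this] False]
    have "((\<lambda>r. T (t - t * r) (w (t * r)))
        has_integral (1 / t) *\<^sub>R integral {0..t} (\<lambda>s. T (t - s) (w s))) {0..1}"
      using t by simp
    thus ?thesis
      using t by (simp add: integral_unique)
  qed simp
  have "continuous_on ({0..} \<times> cbox 0 1) (\<lambda>(t, r). T (t - t * r) (w (t * r)))"
    unfolding case_prod_unfold
    by (intro continuous_on_T_apply continuous_intros continuous_on_compose2[OF assms])
      (auto simp: mult_left_le)
  from integral_continuous_on_param[OF this]
  have "continuous_on {0..} (\<lambda>t. t *\<^sub>R integral {0..1} (\<lambda>r. T (t - t * r) (w (t * r))))"
    by (intro continuous_intros) simp
  thus ?thesis
    by (rule continuous_on_eq) (simp add: eq)
qed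

text \<open>Splitting \<open>exp (- \<omega> * (t - s))\<close> pulls the dependence on
  \<open>t\<close> out of the integral, which leaves the form that Gronwall's inequality
  requires.\<close>

lemma norm_convolution_le:
  assumes "continuous_on {0..t} w" "continuous_on {0..t} b"
    and "\<And>s. s \<in> {0..t} \<Longrightarrow> norm (w s) \<le> b s"
  shows "norm (integral {0..t} (\<lambda>s. T (t - s) (w s)))
    \<le> M * exp (- \<omega> * t) * integral {0..t} (\<lambda>s. exp (\<omega> * s) * b s)"
proof -
  have "norm (integral {0..t} (\<lambda>s. T (t - s) (w s)))
      \<le> integral {0..t} (\<lambda>s. M * exp (- \<omega> * t) * (exp (\<omega> * s) * b s))"
  proof (rule integral_norm_bound_integral)
    fix s assume s: "s \<in> {0..t}"
    have "norm (T (t - s) (w s)) \<le> M * exp (- \<omega> * (t - s)) * norm (w s)"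
      using s by (intro norm_T_apply_exp_le) auto
    also have "\<dots> \<le> M * exp (- \<omega> * (t - s)) * b s"
      using assms(3)[OF s] M_ge_1 by (intro mult_left_mono) auto
    also have "\<dots> = M * exp (- \<omega> * t) * (exp (\<omega> * s) * b s)"
      by (simp add: exp_diff exp_minus field_simps)
    finally show "norm (T (t - s) (w s)) \<le> M * exp (- \<omega> * t) * (exp (\<omega> * s) * b s)" .
  qed (intro integrable_continuous_interval continuous_on_convolution_integrand
      continuous_intros assms)+
  thus ?thesis by simp
qed

text \<open>The weighted norm \<open>u t = exp (\<omega> * t) * norm (v t)\<close> satisfies
  Gronwall's inequality with constant \<open>M * c\<close>. Keeping \<open>w\<close> arbitrary
  serves both solutions and differences of solutions; the bounded interval allows arguments up to a
  first exit time.\<close>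

lemma variation_of_constants_decay:
  assumes v: "continuous_on {0..b} v" and w: "continuous_on {0..b} w"
    and eq: "\<And>t. t \<in> {0..b} \<Longrightarrow> v t = T t v0 + integral {0..t} (\<lambda>s. T (t - s) (w s))"
    and le: "\<And>s. s \<in> {0..b} \<Longrightarrow> norm (w s) \<le> c * norm (v s)" and "c \<ge> 0"
    and t: "t \<in> {0..b}"
  shows "norm (v t) \<le> M * exp (- (\<omega> - M * c) * t) * norm v0"
proof -
  define u where "u t = exp (\<omega> * t) * norm (v t)" for t
  have "u t \<le> (M * norm v0) * exp ((M * c) * t)"
  proof (rule gronwall[OF _ _ _ t])
    show "continuous_on {0..b} u"
      unfolding u_def by (intro continuous_intros v)
    show "M * c \<ge> 0" using M_ge_1 \<open>c \<ge> 0\<close> by simp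
    fix t assume t: "t \<in> {0..b}"
    hence sub: "{0..t} \<subseteq> {0..b}" by auto
    have "norm (v t) \<le> M * exp (- \<omega> * t) * norm v0
        + M * exp (- \<omega> * t) * integral {0..t} (\<lambda>s. exp (\<omega> * s) * (c * norm (v s)))"
      unfolding eq[OF t]
    proof (intro norm_triangle_mono norm_T_apply_exp_le norm_convolution_le)
      show "norm (w s) \<le> c * norm (v s)" if "s \<in> {0..t}" for s
        using le sub that by auto
    qed (use t sub in \<open>auto intro!: continuous_intros
        intro: continuous_on_subset[OF v] continuous_on_subset[OF w]\<close>)
    also have "integral {0..t} (\<lambda>s. exp (\<omega> * s) * (c * norm (v s))) = c * integral {0..t} u"
      by (simp add: u_def mult.left_commute flip: integral_mult_right)
    finally have "norm (v t) \<le> exp (- \<omega> * t) * (M * norm v0 + M * c * integral {0..t} u)"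
      by (simp add: algebra_simps)
    thus "u t \<le> M * norm v0 + M * c * integral {0..t} u"
      by (simp add: u_def exp_minus field_simps)
  qed
  hence "norm (v t) \<le> M * norm v0 * exp (M * c * t) * exp (- (\<omega> * t))"
    by (simp add: u_def exp_minus field_simps)
  also have "\<dots> = M * exp (- (\<omega> - M * c) * t) * norm v0"
    by (simp add: algebra_simps flip: exp_add)
  finally show ?thesis .
qed

section \<open>Global mild solutions for Lipschitz nonlinearities\<close>

text \<open>The weighted Picard map acts on all times at once, so its fixed point is global without
  gluing local solutions. Through \<open>g 0 = 0\<close> the Lipschitz bound yields linear growth,
  which keeps the images bounded.\<close>

lemma mild_solution_exists_lipschitz:
  assumes lip: "\<And>x y. norm (g x - g y) \<le> L * norm (x - y)" and g0: "g 0 = 0" and "L \<ge> 0"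
  shows "\<exists>x. mild_solution T g x0 x"
proof -
  \<comment> \<open>The contraction factor will be \<open>M * L / k\<close>, hence at most 1/2; the
    summand 1 keeps \<open>k\<close> positive when \<open>L = 0\<close>.\<close>
  define k where "k = 2 * M * L + 1"
  have k: "k > 0" "M * L / k \<le> 1 / 2"
  proof -
    have "M * L \<ge> 0" using M_ge_1 \<open>L \<ge> 0\<close> by simp
    thus "k > 0" "M * L / k \<le> 1 / 2" by (simp_all add: k_def field_simps)
  qed
  have cont_g: "continuous_on S g" for S
    using lip \<open>L \<ge> 0\<close>
    by (intro lipschitz_on_continuous_on[of L] lipschitz_onI) (auto simp: dist_norm)
  \<comment> \<open>Working with \<open>z t = exp (- k t) x t\<close>, the growth rate \<open>k\<close> makes the Picard map a contraction.\<close>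
  define y where "y z s = exp (k * s) *\<^sub>R apply_bcontfun z s" for z :: "real \<Rightarrow>\<^sub>C 'x" and s
  have cont_y: "continuous_on S (y z)" for S z
    unfolding y_def by (intro continuous_intros) auto
  have cont_gy: "continuous_on S (\<lambda>s. g (y z s))" for S z
    by (rule continuous_on_compose2[OF cont_g cont_y]) auto
  define I where "I z t = integral {0..t} (\<lambda>s. T (t - s) (g (y z s)))" for z t
  \<comment> \<open>Bounded continuous functions live on the whole line, so \<open>max 0 t\<close>
    extends the Picard map constantly to negative times.\<close>
  define F where "F z t = exp (- k * max 0 t) *\<^sub>R (T (max 0 t) x0 + I z (max 0 t))" for z t
  have cont_I: "continuous_on {0..} (I z)" for z
    unfolding I_def by (intro continuous_on_convolution cont_gy)
  have cont_F: "continuous_on UNIV (F z)" for z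
    unfolding F_def
    by (intro continuous_intros continuous_on_T_apply continuous_on_compose2[OF cont_I]) auto
  \<comment> \<open>The integral of \<open>exp (k * s)\<close> over \<open>{0..t}\<close> is at most
    \<open>exp (k * t) / k\<close>, and the weight cancels the exponential. With
    \<open>B = norm z\<close> this gives boundedness of \<open>F z\<close>, with
    \<open>B = dist z z'\<close> the contraction.\<close>
  have weighted: "exp (- k * t) * norm (integral {0..t} (\<lambda>s. T (t - s) (w s))) \<le> B / 2"
    if t: "t \<ge> 0" and w: "continuous_on {0..t} w" and "B \<ge> 0"
      and le: "\<And>s. s \<in> {0..t} \<Longrightarrow> norm (w s) \<le> L * exp (k * s) * B" for t w B
  proof -
    have "norm (integral {0..t} (\<lambda>s. T (t - s) (w s)))
        \<le> integral {0..t} (\<lambda>s. M * L * B * exp (k * s))"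
    proof (rule integral_norm_bound_integral)
      fix s assume s: "s \<in> {0..t}"
      have "norm (T (t - s) (w s)) \<le> M * norm (w s)"
        using s by (intro norm_T_apply_le) auto
      also have "\<dots> \<le> M * (L * exp (k * s) * B)"
        using le[OF s] M_ge_1 by (intro mult_left_mono) auto
      finally show "norm (T (t - s) (w s)) \<le> M * L * B * exp (k * s)"
        by (simp add: mult_ac)
    qed (intro integrable_continuous_interval continuous_on_convolution_integrand
        continuous_intros w)+
    also have "\<dots> = M * L * B * ((exp (k * t) - 1) / k)"
    proof -
      have "((\<lambda>s. exp (k * s)) has_integral (exp (k * t) / k - exp (k * 0) / k)) {0..t}"
        using t k(1)
        by (intro fundamental_theorem_of_calculus)
          (auto intro!: derivative_eq_intros simp flip: has_real_derivative_iff_has_vector_derivative)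
      thus ?thesis by (simp add: integral_unique diff_divide_distrib)
    qed
    also have "\<dots> \<le> M * L * B * (exp (k * t) / k)"
      using M_ge_1 \<open>L \<ge> 0\<close> \<open>B \<ge> 0\<close> k(1) by (intro mult_left_mono divide_right_mono) auto
    also have "\<dots> = exp (k * t) * ((M * L / k) * B)"
      by simp
    finally have "exp (- k * t) * norm (integral {0..t} (\<lambda>s. T (t - s) (w s))) \<le> (M * L / k) * B"
      by (simp add: exp_minus field_simps)
    also have "\<dots> \<le> (1 / 2) * B"
      using k(2) \<open>B \<ge> 0\<close> by (rule mult_right_mono)
    finally show ?thesis by simp
  qed
  have F_bcontfun: "F z \<in> bcontfun" for z
  proof (rule bcontfun_normI[OF cont_F])
    fix t :: real
    define s where "s = max 0 t"
    have s: "s \<ge> 0" by (simp add: s_def)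
    have "exp (- k * s) * norm (I z s) \<le> norm z / 2"
      unfolding I_def
    proof (rule weighted[OF s cont_gy norm_ge_zero])
      fix r
      have "norm (g (y z r)) \<le> L * norm (y z r)"
        using lip[of "y z r" 0] g0 by simp
      also have "\<dots> \<le> L * (exp (k * r) * norm z)"
        using \<open>L \<ge> 0\<close> norm_bounded[of z r] by (intro mult_left_mono) (auto simp: y_def)
      finally show "norm (g (y z r)) \<le> L * exp (k * r) * norm z" by simp
    qed
    moreover have "exp (- k * s) * norm (T s x0) \<le> 1 * (M * norm x0)"
      using s k(1) norm_T_apply_le[OF s] by (intro mult_mono) auto
    moreover have "norm (F z t) \<le> exp (- k * s) * (norm (T s x0) + norm (I z s))"
      unfolding F_def s_def[symmetric] by (simp add: norm_triangle_ineq)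
    ultimately show "norm (F z t) \<le> M * norm x0 + norm z / 2"
      by (simp add: distrib_left)
  qed
  have "\<exists>!z. Bcontfun (F z) = z"
  proof (rule banach_fix_type[of "1/2"])
    show "\<forall>z z'. dist (Bcontfun (F z)) (Bcontfun (F z')) \<le> 1 / 2 * dist z z'"
    proof (intro allI dist_bound)
      fix z z' and t :: real
      define s where "s = max 0 t"
      have s: "s \<ge> 0" by (simp add: s_def)
      have integrable: "(\<lambda>r. T (s - r) (g (y z r))) integrable_on {0..s}" for z
        by (intro integrable_continuous_interval continuous_on_convolution_integrand cont_gy)
      have "F z t - F z' t = exp (- k * s) *\<^sub>R (I z s - I z' s)"
        by (simp add: F_def s_def scaleR_diff_right scaleR_add_right)
      also have "I z s - I z' s = integral {0..s} (\<lambda>r. T (s - r) (g (y z r) - g (y z' r)))"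
        unfolding I_def blinfun.diff_right
        by (rule Henstock_Kurzweil_Integration.integral_diff[symmetric]) (rule integrable)+
      finally have "dist (F z t) (F z' t)
          = exp (- k * s) * norm (integral {0..s} (\<lambda>r. T (s - r) (g (y z r) - g (y z' r))))"
        by (simp add: dist_norm)
      also have "\<dots> \<le> dist z z' / 2"
      proof (rule weighted[OF s _ zero_le_dist])
        fix r
        have "norm (y z r - y z' r) = exp (k * r) * dist (apply_bcontfun z r) (apply_bcontfun z' r)"
          by (simp add: y_def dist_norm flip: scaleR_diff_right)
        also have "\<dots> \<le> exp (k * r) * dist z z'"
          by (intro mult_left_mono dist_bounded) auto
        finally show "norm (g (y z r) - g (y z' r)) \<le> L * exp (k * r) * dist z z'"
          using order_trans[OF lip mult_left_mono[OF _ \<open>L \<ge> 0\<close>]] by (simp add: mult.assoc)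
      qed (intro continuous_intros cont_gy)
      finally show "dist (Bcontfun (F z) t) (Bcontfun (F z') t) \<le> 1 / 2 * dist z z'"
        by (simp add: Bcontfun_inverse[OF F_bcontfun])
    qed
  qed auto
  then obtain z where "Bcontfun (F z) = z" by blast
  hence z: "apply_bcontfun z = F z"
    using Bcontfun_inverse[OF F_bcontfun[of z]] by simp
  \<comment> \<open>Multiplying by \<open>exp (k * t)\<close> undoes the weight and turns the fixed
    point equation into the variation of constants formula.\<close>
  have "y z t = T t x0 + I z t" if "t \<ge> 0" for t
    using that by (simp add: y_def z F_def flip: exp_add)
  hence "mild_solution T g x0 (y z)"
    unfolding mild_solution_def I_def
    by (auto intro!: cont_y integrable_continuous_interval continuous_on_convolution_integrand cont_gy)
  thus ?thesis by blast
qed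

section \<open>Local exponential stability\<close>

theorem locally_exponentially_stable_of_derivative_zero:
  assumes lip: "locally_lipschitz f" and f0: "f 0 = 0"
    and deriv: "(f has_derivative (\<lambda>_. 0)) (at 0)"
  shows "locally_exponentially_stable T f"
proof -
  \<comment> \<open>The nonlinearity may consume half of the decay rate:
    \<open>\<omega> - M * e = \<omega> / 2\<close>.\<close>
  define e where "e = \<omega> / (2 * M)"
  have e: "e > 0" "M * e = \<omega> / 2"
    using M_ge_1 \<omega>_pos by (auto simp: e_def)
  obtain u L where u: "u > 0" and L: "L-lipschitz_on (cball 0 u) f"
    using lip unfolding locally_lipschitz_def by blast
  obtain d' where d': "d' > 0" "\<And>x. norm x < d' \<Longrightarrow> norm (f x) \<le> e * norm x"
    using deriv e f0 unfolding has_derivative_at_alt by fastforce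
  \<comment> \<open>On the closed ball of radius \<open>d\<close> both the Lipschitz bound and the
    smallness of \<open>f\<close> hold; halving \<open>d'\<close> respects the strict inequality in
    its choice.\<close>
  define d where "d = min u (d' / 2)"
  have d: "d > 0" using u d' by (simp add: d_def)
  have small: "norm (f x) \<le> e * norm x" if "norm x \<le> d" for x
    using that d' by (intro d'(2)) (auto simp: d_def)
  have lip_d: "norm (f x - f y) \<le> L * norm (x - y)" if "norm x \<le> d" "norm y \<le> d" for x y
    using lipschitz_onD[OF L, of x y] that by (auto simp: dist_norm d_def)
  have "L \<ge> 0" using L by (rule lipschitz_on_nonneg)
  have cont_f: "continuous_on S f" for S
    using lip by (rule locally_lipschitz_imp_continuous_on)
  have cont_fx: "continuous_on {0..b} x \<Longrightarrow> continuous_on {0..b} (\<lambda>s. f (x s))"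
    for x :: "real \<Rightarrow> 'x" and b
    by (rule continuous_on_compose2[OF cont_f]) auto
  define g where "g x = f (radial_retraction d x)" for x
  have g_lip: "norm (g x - g y) \<le> (2 * L) * norm (x - y)" for x y
    using order_trans[OF lip_d mult_left_mono[OF norm_radial_retraction_diff_le \<open>L \<ge> 0\<close>], of d x y]
    by (simp add: g_def norm_radial_retraction d mult_ac)
  have g_eq: "g x = f x" if "norm x \<le> d" for x
    using that d by (simp add: g_def radial_retraction_id)
  have g_small: "norm (g x) \<le> e * norm x" for x
    using order_trans[OF small mult_left_mono[OF norm_radial_retraction(2)]] e d
    by (simp add: g_def norm_radial_retraction)
  \<comment> \<open>The witnesses for stability are the radius \<open>d / M\<close>, the constant
    \<open>M\<close> and the rate \<open>\<omega> / 2\<close>. This radius makes the decay bound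
    itself force the norm below \<open>d\<close>.\<close>
  have ex: "\<exists>x. mild_solution T f x0 x \<and>
             (\<forall>y. mild_solution T f x0 y \<longrightarrow> (\<forall>t\<ge>0. y t = x t)) \<and>
             (\<forall>t\<ge>0. norm (x t) \<le> M * exp (- (\<omega> / 2) * t) * norm x0)"
    if x0: "norm x0 < d / M" for x0
  proof -
    have Mx0: "M * norm x0 < d"
      using x0 M_ge_1 by (simp add: field_simps)
    have less_d: "norm a < d" if "norm a \<le> M * exp (- (\<omega> / 2) * t) * norm x0" "t \<ge> 0"
      for a :: 'x and t
    proof -
      have "M * exp (- (\<omega> / 2) * t) * norm x0 \<le> M * 1 * norm x0"
        using M_ge_1 \<omega>_pos that(2) by (intro mult_right_mono mult_left_mono) auto
      thus ?thesis using that Mx0 by simp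
    qed
    \<comment> \<open>Here \<open>h\<close> is \<open>g\<close> for the constructed solution and
      \<open>f\<close> for a competing one, whose smallness estimate is known only while it stays in
      the ball.\<close>
    have decay: "norm (v t) \<le> M * exp (- (\<omega> / 2) * t) * norm x0"
      if "continuous_on {0..t} v" "continuous_on {0..t} (\<lambda>s. h (v s))" "t \<ge> 0"
        "\<And>r. r \<in> {0..t} \<Longrightarrow> v r = T r x0 + integral {0..r} (\<lambda>s. T (r - s) (h (v s)))"
        "\<And>s. s \<in> {0..t} \<Longrightarrow> norm (h (v s)) \<le> e * norm (v s)"
      for v t h
      using variation_of_constants_decay[OF that(1,2,4,5), of t] e that(3) by simp
    obtain x where x: "mild_solution T g x0 x"
      using mild_solution_exists_lipschitz[of g "2 * L" x0] g_lip \<open>L \<ge> 0\<close> g_eq[of 0] f0 d by auto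
    hence cont_x: "continuous_on {0..} x"
      by (simp add: mild_solution_def)
    have cont_g: "continuous_on S g" for S
      using g_lip \<open>L \<ge> 0\<close>
      by (intro lipschitz_on_continuous_on[of "2 * L"] lipschitz_onI) (auto simp: dist_norm)
    have x_decay: "norm (x t) \<le> M * exp (- (\<omega> / 2) * t) * norm x0" if "t \<ge> 0" for t
    proof (rule decay[where h = g])
      show cx: "continuous_on {0..t} x" using cont_x by (rule continuous_on_subset) auto
      show "continuous_on {0..t} (\<lambda>s. g (x s))" by (rule continuous_on_compose2[OF cont_g cx]) auto
    qed (use x g_small that in \<open>auto simp: mild_solution_def\<close>)
    have x_f: "mild_solution T f x0 x"
    proof -
      have "g (x s) = f (x s)" if "s \<ge> 0" for s
        using less_d[OF x_decay[OF that] that] by (simp add: g_eq)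
      hence "integral {0..t} (\<lambda>s. T (t - s) (g (x s))) = integral {0..t} (\<lambda>s. T (t - s) (f (x s)))"
        and "(\<lambda>s. T (t - s) (g (x s))) integrable_on {0..t} \<longleftrightarrow>
          (\<lambda>s. T (t - s) (f (x s))) integrable_on {0..t}" for t
        by (auto intro!: integral_cong integrable_cong)
      thus ?thesis using x by (simp add: mild_solution_def)
    qed
    have "y t = x t" if y: "mild_solution T f x0 y" and t: "t \<ge> 0" for y t
    proof -
      have cont_y: "continuous_on {0..b} y" and cont_x': "continuous_on {0..b} x" for b
        using y cont_x by (auto simp: mild_solution_def elim: continuous_on_subset)
      \<comment> \<open>First exit argument: at the first time \<open>q\<close> with
        \<open>d \<le> norm (y q)\<close>, the decay estimate on \<open>{0..q}\<close> still gives
        \<open>norm (y q) < d\<close>, a contradiction.\<close>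
      have y_lt: "norm (y s) < d" if "s \<ge> 0" for s
      proof (rule ccontr)
        assume s: "\<not> norm (y s) < d"
        define S where "S = {r \<in> {0..s}. d \<le> norm (y r)}"
        have "compact S"
        proof -
          have "closed S"
            unfolding S_def by (intro continuous_on_closed_Collect_le continuous_intros cont_y)
          moreover have "S = {0..s} \<inter> S" by (auto simp: S_def)
          ultimately show ?thesis by (metis compact_Int_closed compact_Icc)
        qed
        moreover have "s \<in> S" using s that by (auto simp: S_def)
        ultimately obtain q where q: "q \<in> S" "\<And>r. r \<in> S \<Longrightarrow> q \<le> r"
          using compact_attains_inf[of S] by auto
        have before: "norm (y r) < d" if "r \<in> {0..<q}" for r
          using q that by (force simp: S_def)
        have "norm (y q) < d"
        proof (cases "q = 0")
          case True
          have "y 0 = x0" using y T_zero by (auto simp: mild_solution_def)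
          thus ?thesis using Mx0 M_ge_1 mult_right_mono[of 1 M "norm x0"] True by simp
        next
          case False
          have "q \<ge> 0" using q by (simp add: S_def)
          hence "q > 0" using False by simp
          \<comment> \<open>Continuity carries the bound from \<open>{0..<q}\<close> to its closure,
            which is \<open>{0..q}\<close> only for positive \<open>q\<close>; hence the separate
            case \<open>q = 0\<close>.\<close>
          have le: "norm (y r) \<le> d" if "r \<in> {0..q}" for r
          proof (rule continuous_le_on_closure[where S = "{0..<q}" and f = "\<lambda>r. norm (y r)"])
            show "continuous_on (closure {0..<q}) (\<lambda>r. norm (y r))"
              using \<open>q > 0\<close> by (auto intro!: continuous_intros cont_y)
          qed (use that \<open>q > 0\<close> before in \<open>auto intro: less_imp_le\<close>)
          show ?thesis
          proof (rule less_d[OF decay[where h = f] \<open>q \<ge> 0\<close>])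
            show "norm (f (y r)) \<le> e * norm (y r)" if "r \<in> {0..q}" for r
              using le[OF that] by (rule small)
          qed (use y \<open>q \<ge> 0\<close> in \<open>auto simp: mild_solution_def intro!: cont_y cont_fx\<close>)
        qed
        thus False using q by (simp add: S_def)
      qed
      \<comment> \<open>Both solutions lie in the ball where \<open>f\<close> is
        \<open>L\<close>-Lipschitz, and their difference starts at 0. The rate
        \<open>\<omega> - M * L\<close> may be negative, but the factor \<open>norm 0\<close> makes
        the bound vanish.\<close>
      have "norm (y t - x t) \<le> M * exp (- (\<omega> - M * L) * t) * norm (0 :: 'x)"
      proof (rule variation_of_constants_decay)
        show "norm (f (y s) - f (x s)) \<le> L * norm (y s - x s)" if "s \<in> {0..t}" for s
          using that y_lt[of s] less_d[OF x_decay, of s] by (intro lip_d) auto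
        show "y r - x r = T r 0 + integral {0..r} (\<lambda>s. T (r - s) (f (y s) - f (x s)))"
          if "r \<in> {0..t}" for r
          using y x_f that unfolding mild_solution_def blinfun.diff_right
          by (simp add: Henstock_Kurzweil_Integration.integral_diff)
      qed (use t \<open>L \<ge> 0\<close> in \<open>auto intro!: continuous_intros cont_y cont_x' cont_fx\<close>)
      thus ?thesis by simp
    qed
    thus ?thesis using x_f x_decay by blast
  qed
  have "d / M > 0" "M > 0" "\<omega> / 2 > 0"
    using d M_ge_1 \<omega>_pos by auto
  thus ?thesis
    unfolding locally_exponentially_stable_def using ex by blast
qed

end

theorem theorem2p1:
  fixes smul :: "'k::real_or_complex \<Rightarrow> 'x::banach \<Rightarrow> 'x"
    and ip :: "'x \<Rightarrow> 'x \<Rightarrow> 'k"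
    and T :: "real \<Rightarrow> 'x \<Rightarrow>\<^sub>L 'x"
    and D :: "'x set"
    and A :: "'x \<Rightarrow> 'x"
    and f :: "'x \<Rightarrow> 'x"
  assumes "hilbert_space smul ip"
    and "c0_semigroup smul T"
    and "infinitesimal_generator T D A"
    and "locally_lipschitz f"
    and "f 0 = 0"
    and "(f has_derivative (\<lambda>_. 0)) (at 0)"
    and "exponentially_stable_semigroup T"
    and "\<exists>(\<omega>::real) (Q :: 'x \<Rightarrow>\<^sub>L 'x).
           Vector_Spaces.linear smul smul (blinfun_apply Q) \<and>
           boundedly_invertible Q \<and> self_adjoint_wrt ip Q \<and>
           (\<forall>x\<in>D. ip x (Q (A x)) + ip (A x) (Q x) \<le> of_real (\<omega> * (norm x)\<^sup>2))"
  shows "locally_exponentially_stable T f"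
proof -
  obtain M \<omega>\<^sub>0 where M: "\<omega>\<^sub>0 > 0" "\<And>t. t \<ge> 0 \<Longrightarrow> norm (T t) \<le> M * exp (- \<omega>\<^sub>0 * t)"
    using assms(7) unfolding exponentially_stable_semigroup_def by blast
  \<comment> \<open>Enlarging \<open>M\<close> to \<open>max 1 M\<close> preserves the exponential
    bound and secures \<open>M_ge_1\<close>.\<close>
  interpret exponentially_bounded_semigroup T "max 1 M" \<omega>\<^sub>0
  proof
    show "norm (T t) \<le> max 1 M * exp (- \<omega>\<^sub>0 * t)" if "t \<ge> 0" for t
      by (rule order_trans[OF M(2)[OF that] mult_right_mono]) auto
  qed (use M(1) assms(2) in \<open>auto simp: c0_semigroup_def\<close>)
  show ?thesis
    using assms(4-6) by (rule locally_exponentially_stable_of_derivative_zero)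
qed

end
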